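(* Let $(K,|\cdot|)$ be a non-Archimedean nontrivially valued field with ring of integers $D$, $\varepsilon\in(0,1]$ and $n\ge2$. Then any ball (open or closed, of positive radius) and any sphere (of positive radius) in $K^n$ containing $\mathbf 0$ is $\mathrm{SA}(n,D,\varepsilon)$-paradoxical using $4$ pieces.
   Context: A non-Archimedean valuation on a field $K$ is a function $|\cdot|:K\to[0,\infty)$ with $|x|=0\iff x=0$, $|xy|=|x||y|$, $|x+y|\le\max\{|x|,|y|\}$; it is nontrivial if $\{|x|:x\in K,x\neq0\}\ne\{1\}$. $D=\{x\in K:|x|\le1\}$ is the ring of integers. $K^n$ carries the norm $\|x\|=\max_i|x_i|$. For $r>0$: $B[x,r]=\{y:\|y-x\|\le r\}$, $B(x,r)=\{y:\|y-x\|<r\}$, $S[x,r]=\{y:\|y-x\|=r\}$. For $\varepsilon\in(0,1]$, $\mathrm{SL}(n,D,\varepsilon)$ is the group of matrices $[a_{ij}]\in\mathrm{SL}(n,D)$ with $|a_{ii}-1|<\varepsilon$ for all $i$ and $|a_{ij}|<\varepsilon$ for $i\neq j$, and $\mathrm{SA}(n,D,\varepsilon)$ is the group of affine maps $K^n\to K^n$, $x\mapsto L(x)+\tau$, with $L\in\mathrm{SL}(n,D,\varepsilon)$ and $\tau\in D^n$. For a group $G$ acting on a set $X$ and $A,B\subseteq X$, write $A\sim_{G,m}B$ if there are partitions $A=\bigsqcup_{i=1}^mA_i$, $B=\bigsqcup_{i=1}^mB_i$ into (possibly empty) subsets and $g_1,\dots,g_m\in G$ with $g_i(A_i)=B_i$.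 A nonempty set $E\subseteq X$ is $G$-paradoxical using $s$ pieces if $E=A\sqcup B$ with $A\sim_{G,m}E$ and $B\sim_{G,l}E$ for some $m,l\ge1$ with $m+l=s$. The axiom of choice is assumed. *)

theory Defs
  imports "HOL-Analysis.Determinants" "HOL-Library.Disjoint_Sets"
begin

locale nonarch_valuation =
  fixes v :: "'a::field \<Rightarrow> real"
  assumes v_nonneg: "0 \<le> v x"
    and v_eq_0_iff: "v x = 0 \<longleftrightarrow> x = 0"
    and v_mult: "v (x * y) = v x * v y"
    and v_add_le: "v (x + y) \<le> max (v x) (v y)"

definition nontrivial_valuation :: "('a::field \<Rightarrow> real) \<Rightarrow> bool" where
  "nontrivial_valuation v \<longleftrightarrow> {v x | x. x \<noteq> 0} \<noteq> {1}"

definition ring_of_integers :: "('a::field \<Rightarrow> real) \<Rightarrow> 'a set" where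
  "ring_of_integers v = {x. v x \<le> 1}"

definition max_norm :: "('a::field \<Rightarrow> real) \<Rightarrow> 'a ^ 'n \<Rightarrow> real" where
  "max_norm v x = Max (range (\<lambda>i. v (x $ i)))"

definition closed_ball :: "('a::field \<Rightarrow> real) \<Rightarrow> 'a ^ 'n \<Rightarrow> real \<Rightarrow> ('a ^ 'n) set" where
  "closed_ball v x r = {y. max_norm v (y - x) \<le> r}"

definition open_ball :: "('a::field \<Rightarrow> real) \<Rightarrow> 'a ^ 'n \<Rightarrow> real \<Rightarrow> ('a ^ 'n) set" where
  "open_ball v x r = {y. max_norm v (y - x) < r}"

definition val_sphere :: "('a::field \<Rightarrow> real) \<Rightarrow> 'a ^ 'n \<Rightarrow> real \<Rightarrow> ('a ^ 'n) set" where
  "val_sphere v x r = {y. max_norm v (y - x) = r}"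

definition SL_eps :: "('a::field \<Rightarrow> real) \<Rightarrow> real \<Rightarrow> ('a ^ 'n ^ 'n) set" where
  "SL_eps v \<epsilon> =
    {L. (\<forall>i j. L $ i $ j \<in> ring_of_integers v) \<and> det L = 1 \<and>
        (\<forall>i. v (L $ i $ i - 1) < \<epsilon>) \<and>
        (\<forall>i j. i \<noteq> j \<longrightarrow> v (L $ i $ j) < \<epsilon>)}"

definition SA_eps :: "('a::field \<Rightarrow> real) \<Rightarrow> real \<Rightarrow> ('a ^ 'n \<Rightarrow> 'a ^ 'n) set" where
  "SA_eps v \<epsilon> =
    {\<lambda>x. L *v x + \<tau> | L \<tau>. L \<in> SL_eps v \<epsilon> \<and> (\<forall>i. \<tau> $ i \<in> ring_of_integers v)}"

text \<open>A group acting on a set is given below as the set of transformations by which it acts;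
  the pieces of a partition may be empty.\<close>

definition equidecomposable :: "('x \<Rightarrow> 'x) set \<Rightarrow> nat \<Rightarrow> 'x set \<Rightarrow> 'x set \<Rightarrow> bool" where
  "equidecomposable G m A B \<longleftrightarrow>
    (\<exists>P Q g. disjoint_family_on P {1..m} \<and> (\<Union>i\<in>{1..m}. P i) = A \<and>
             disjoint_family_on Q {1..m} \<and> (\<Union>i\<in>{1..m}. Q i) = B \<and>
             (\<forall>i\<in>{1..m}. g i \<in> G \<and> g i ` P i = Q i))"

definition paradoxical :: "('x \<Rightarrow> 'x) set \<Rightarrow> nat \<Rightarrow> 'x set \<Rightarrow> bool" where
  "paradoxical G s E \<longleftrightarrow>
    E \<noteq> {} \<and>
    (\<exists>A B m l. A \<union> B = E \<and> A \<inter> B = {} \<and> 1 \<le> m \<and> 1 \<le> l \<and> m + l = s \<and>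
               equidecomposable G m A E \<and> equidecomposable G l B E)"

end

(* Two affine maps a, b of a coordinate plane, composed of shears with entries in t * Z[t] for an
   element t of very small valuation, preserve E. A second absolute value for which t is large (the
   usual one on the integers, or the degree valuation on Z[t]) extends to a seminorm nu on all of K.
   The points at which nu fails to grow under one of a, a^-1, b, b^-1 form strips around four lines
   in general position, so the truncated height max 2 (nu x_i) (nu x_j) has at most two non-growing
   directions at any point, and only one if it drops. Hence every component of the Schreier graph
   contains at most one cycle, which allows a bijection between edges and vertices that sends every
   edge to one of its endpoints; such a bijection is the same as a paradoxical decomposition with
   four pieces. *)

theory Submission
  imports Defs "HOL-Computational_Algebra.Polynomial"
begin

subsection \<open>Paradoxical decompositions from a height function\<close>

text \<open>Joining each \<open>x\<close> to \<open>\<rho> x\<close> and \<open>\<sigma> x\<close>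
  gives a graph whose finite cycles have even length. The two colour classes of a component are two
  orbits of \<open>T\<close>, and one of them is chosen for each component.\<close>

lemma fixpoint_free_involutions_colouring:
  fixes \<rho> \<sigma> :: "'d \<Rightarrow> 'd"
  assumes \<rho>: "\<And>x. \<rho> (\<rho> x) = x" "\<And>x. \<rho> x \<noteq> x"
    and \<sigma>: "\<And>x. \<sigma> (\<sigma> x) = x" "\<And>x. \<sigma> x \<noteq> x"
  shows "\<exists>C. \<forall>x. (\<rho> x \<in> C \<longleftrightarrow> x \<notin> C) \<and> (\<sigma> x \<in> C \<longleftrightarrow> x \<notin> C)"
proof -
  define T where "T = (\<lambda>x. \<sigma> (\<rho> x))"
  have inj: "(T ^^ n) x = (T ^^ n) y \<Longrightarrow> x = y" for n x y
  proof (induction n)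
    case (Suc n)
    then show ?case by (metis T_def \<rho>(1) \<sigma>(1) funpow.simps(2) o_apply)
  qed simp
  \<comment> \<open>\<open>\<rho>\<close> conjugates \<open>T\<close> to its inverse, written here
    without inverses.\<close>
  have conj: "(T ^^ n) (\<rho> ((T ^^ n) x)) = \<rho> x" for n x
  proof (induction n arbitrary: x)
    case (Suc n)
    have "(T ^^ Suc n) (\<rho> ((T ^^ Suc n) x)) = T ((T ^^ n) (\<rho> ((T ^^ n) (T x))))"
      by (simp add: funpow_swap1)
    also have "\<dots> = T (\<rho> (T x))" by (simp add: Suc)
    also have "\<dots> = \<rho> x" by (simp add: T_def \<rho> \<sigma>)
    finally show ?case .
  qed simp
  \<comment> \<open>Two-sided orbits of the injective map \<open>T\<close>, encoded by forward
    powers only.\<close>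
  define cls where "cls = (\<lambda>x. {y. \<exists>j k. (T ^^ j) x = (T ^^ k) y})"
  have refl: "x \<in> cls x" for x by (auto simp: cls_def)
  have sym: "y \<in> cls x \<Longrightarrow> x \<in> cls y" for x y unfolding cls_def by (auto, metis)
  have trans: "z \<in> cls x" if "y \<in> cls x" "z \<in> cls y" for x y z
  proof -
    from that obtain j k l m where jk: "(T ^^ j) x = (T ^^ k) y" and lm: "(T ^^ l) y = (T ^^ m) z"
      by (auto simp: cls_def)
    have "(T ^^ (l + j)) x = (T ^^ (l + k)) y" by (simp add: funpow_add jk)
    also have "\<dots> = (T ^^ (k + l)) y" by (simp only: add.commute)
    also have "\<dots> = (T ^^ (k + m)) z" by (simp add: funpow_add lm)
    finally have "(T ^^ (l + j)) x = (T ^^ (k + m)) z" .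
    then show ?thesis by (auto simp: cls_def)
  qed
  have cls_eq: "cls x = cls y" if "y \<in> cls x" for x y
    using that sym trans by blast
  \<comment> \<open>By \<open>conj\<close>, the point halfway along such a path would give a fixed
    point: of \<open>\<rho>\<close> for even \<open>m\<close>, of \<open>\<sigma>\<close> for odd
    \<open>m\<close>.\<close>
  have no_shift: "(T ^^ m) x \<noteq> \<rho> x" for m x
  proof
    assume eq: "(T ^^ m) x = \<rho> x"
    show False
    proof (cases "even m")
      case True
      then obtain i where "m = i + i" by (metis evenE mult_2)
      then have "(T ^^ i) ((T ^^ i) x) = (T ^^ i) (\<rho> ((T ^^ i) x))"
        using eq conj by (simp add: funpow_add)
      then show False using inj \<rho>(2) by metis
    next
      case False
      then obtain i where "m = i + Suc i" by (metis oddE mult_2 Suc_eq_plus1 add_Suc_right)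
      then have "(T ^^ i) (T ((T ^^ i) x)) = (T ^^ i) (\<rho> ((T ^^ i) x))"
        using eq conj by (simp add: funpow_add funpow_swap1)
      then show False using inj \<sigma>(2) unfolding T_def by metis
    qed
  qed
  have not_cls: "\<rho> x \<notin> cls x" for x
  proof
    assume "\<rho> x \<in> cls x"
    then obtain j k where jk: "(T ^^ j) x = (T ^^ k) (\<rho> x)" by (auto simp: cls_def)
    show False
    proof (cases "k \<le> j")
      case True
      then obtain m where "j = k + m" by (metis le_Suc_ex)
      then have "(T ^^ m) x = \<rho> x" using jk inj by (simp add: funpow_add)
      then show False using no_shift by blast
    next
      case False
      then obtain m where "k = j + m" by (metis le_Suc_ex nat_le_linear)
      then have "(T ^^ m) (\<rho> x) = \<rho> (\<rho> x)" using jk inj by (simp add: funpow_add \<rho>(1)) metis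
      then show False using no_shift by blast
    qed
  qed
  have cls_\<rho>: "cls (\<rho> x) \<noteq> cls x" for x using not_cls refl by metis
  have "(T ^^ 0) (\<sigma> x) = (T ^^ 1) (\<rho> x)" for x by (simp add: T_def \<rho>)
  then have cls_\<sigma>: "cls (\<sigma> x) = cls (\<rho> x)" for x
    using cls_eq unfolding cls_def by blast
  have "(T ^^ 1) (\<rho> (\<sigma> x)) = (T ^^ 0) x" for x by (simp add: T_def \<rho> \<sigma>)
  then have cls_\<rho>\<sigma>: "cls (\<rho> (\<sigma> x)) = cls x" for x
    using cls_eq unfolding cls_def by blast
  \<comment> \<open>The unordered pair is the same for \<open>x\<close>, \<open>\<rho> x\<close> and
    \<open>\<sigma> x\<close>, so the choice is constant on components.\<close>
  define pick where "pick = (\<lambda>x. SOME c. c \<in> {cls x, cls (\<rho> x)})"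
  have pick_in: "pick x \<in> {cls x, cls (\<rho> x)}" for x
    unfolding pick_def by (rule someI_ex) auto
  have pick: "pick (\<rho> x) = pick x" "pick (\<sigma> x) = pick x" for x
    by (simp_all add: pick_def \<rho> cls_\<sigma> cls_\<rho>\<sigma> disj_commute)
  show ?thesis
    by (rule exI[of _ "{x. cls x = pick x}"]) (use pick pick_in cls_\<rho> cls_\<sigma> in \<open>auto; metis\<close>)
qed

text \<open>The fixed points of \<open>\<sigma>\<close> are removed by doubling the set and joining the two copies there.\<close>

lemma involutions_colouring:
  fixes \<rho> \<sigma> :: "'d \<Rightarrow> 'd"
  assumes \<rho>: "\<And>x. \<rho> (\<rho> x) = x" "\<And>x. \<rho> x \<noteq> x" and \<sigma>: "\<And>x. \<sigma> (\<sigma> x) = x"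
  shows "\<exists>C. \<forall>x. (\<rho> x \<in> C \<longleftrightarrow> x \<notin> C) \<and> (\<sigma> x \<noteq> x \<longrightarrow> (\<sigma> x \<in> C \<longleftrightarrow> x \<notin> C))"
proof -
  define \<rho>' where "\<rho>' = (\<lambda>(x, b::bool). (\<rho> x, b))"
  define \<sigma>' where "\<sigma>' = (\<lambda>(x, b). if \<sigma> x = x then (x, \<not> b) else (\<sigma> x, b))"
  have "\<exists>C. \<forall>x. (\<rho>' x \<in> C \<longleftrightarrow> x \<notin> C) \<and> (\<sigma>' x \<in> C \<longleftrightarrow> x \<notin> C)"
  proof (rule fixpoint_free_involutions_colouring)
    fix p :: "'d \<times> bool"
    show "\<rho>' (\<rho>' p) = p" "\<rho>' p \<noteq> p" "\<sigma>' (\<sigma>' p) = p" "\<sigma>' p \<noteq> p"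
      by (cases p, use assms in \<open>simp add: \<rho>'_def \<sigma>'_def; metis\<close>)+
  qed
  then obtain C where C: "\<And>x. (\<rho>' x \<in> C \<longleftrightarrow> x \<notin> C) \<and> (\<sigma>' x \<in> C \<longleftrightarrow> x \<notin> C)" by blast
  have "(\<rho> x, True) \<in> C \<longleftrightarrow> (x, True) \<notin> C" "\<sigma> x \<noteq> x \<Longrightarrow> (\<sigma> x, True) \<in> C \<longleftrightarrow> (x, True) \<notin> C" for x
    using C[of "(x, True)"] by (auto simp: \<rho>'_def \<sigma>'_def)
  then show ?thesis by (intro exI[of _ "{x. (x, True) \<in> C}"]) auto
qed

text \<open>The Cantor-Schroeder-Bernstein construction, remembering that every matched pair comes
  from \<open>i\<close> or from \<open>j\<close>. If both respect incidence of edges and vertices,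
  so does \<open>\<phi>\<close>.\<close>

lemma injections_common_bijection:
  fixes i :: "'v \<Rightarrow> 'e" and j :: "'e \<Rightarrow> 'v"
  assumes "inj i" "inj j"
  shows "\<exists>\<phi>. bij \<phi> \<and> (\<forall>e. \<phi> e = j e \<or> i (\<phi> e) = e)"
proof -
  \<comment> \<open>Elements whose backward chain ends outside \<open>range i\<close>; on these
    \<open>j\<close> is used, elsewhere the inverse of \<open>i\<close>.\<close>
  define S where "S = (\<Union>n. ((i \<circ> j) ^^ n) ` (- range i))"
  define \<phi> where "\<phi> = (\<lambda>e. if e \<in> S then j e else inv i e)"
  have "e \<in> ((i \<circ> j) ^^ 0) ` (- range i)" if "e \<notin> range i" for e using that by simp
  then have base: "e \<notin> range i \<Longrightarrow> e \<in> S" for e unfolding S_def by blast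
  have step: "i (j e) \<in> S" if "e \<in> S" for e
  proof -
    from that obtain n x where "x \<in> - range i" "e = ((i \<circ> j) ^^ n) x" by (auto simp: S_def)
    then have "i (j e) \<in> ((i \<circ> j) ^^ Suc n) ` (- range i)" by auto
    then show ?thesis unfolding S_def by blast
  qed
  have preim: "\<exists>e\<in>S. y = j e" if "i y \<in> S" for y
  proof -
    from that obtain n x where x: "x \<in> - range i" "i y = ((i \<circ> j) ^^ n) x" by (auto simp: S_def)
    then obtain m where m: "n = Suc m" by (cases n) auto
    then have "i y = i (j (((i \<circ> j) ^^ m) x))" using x by simp
    then have "y = j (((i \<circ> j) ^^ m) x)" using assms(1) by (simp add: inj_eq)
    then show ?thesis using x by (auto simp: S_def)
  qed
  have out: "i (\<phi> e) = e" if "e \<notin> S" for e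
    using that base[of e] f_inv_into_f[of e i UNIV] by (auto simp: \<phi>_def)
  have "inj \<phi>"
  proof (rule injI)
    fix e e' assume eq: "\<phi> e = \<phi> e'"
    have "\<phi> e \<noteq> \<phi> e'" if "e \<in> S" "e' \<notin> S" for e e'
      using that step[of e] out[of e'] by (auto simp: \<phi>_def)
    then have "e \<in> S \<longleftrightarrow> e' \<in> S" using eq by metis
    then show "e = e'" using eq out assms(2) by (metis \<phi>_def injD)
  qed
  moreover have "\<exists>e. \<phi> e = y" for y
  proof (cases "i y \<in> S")
    case True
    then show ?thesis using preim by (metis \<phi>_def)
  next
    case False
    then show ?thesis using assms(1) by (intro exI[of _ "i y"]) (simp add: \<phi>_def)
  qed
  ultimately have "bij \<phi>" by (auto simp: bij_def surj_def) metis
  moreover have "\<forall>e. \<phi> e = j e \<or> i (\<phi> e) = e" using out by (auto simp: \<phi>_def)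
  ultimately show ?thesis by blast
qed

lemma equidecomposable_two_pieces:
  assumes "id \<in> G" "f \<in> G" "A \<inter> B = {}" "A \<union> B = X" "A \<inter> f ` B = {}" "A \<union> f ` B = Y"
  shows "equidecomposable G 2 X Y"
proof -
  have two: "{1..2} = {1, 2::nat}" by force
  define P where "P = (\<lambda>i::nat. if i = 1 then A else B)"
  define Q where "Q = (\<lambda>i::nat. if i = 1 then A else f ` B)"
  define g where "g = (\<lambda>i::nat. if i = 1 then id else f)"
  have "disjoint_family_on P {1..2}" "disjoint_family_on Q {1..2}"
    "(\<Union>i\<in>{1..2}. P i) = X" "(\<Union>i\<in>{1..2}. Q i) = Y" "\<forall>i\<in>{1..2}. g i \<in> G \<and> g i ` P i = Q i"
    using assms by (auto simp: two[simplified] P_def Q_def g_def disjoint_family_on_def)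
  then show ?thesis unfolding equidecomposable_def by blast
qed

text \<open>The Schreier graph has a vertex for each point and an edge \<open>(x, e)\<close> joining \<open>x\<close> to
  \<open>step (e, False) x\<close>. A bijection from edges to vertices sending every edge to one of its
  endpoints is exactly a paradoxical decomposition into \<open>2 + 2\<close> pieces. The height provides an injection
  in each direction: a vertex is sent to an edge going up, an edge to its upper endpoint, and the
  edges joining points of equal height form paths and cycles, which can be oriented.\<close>

lemma paradoxical_of_height:
  fixes step :: "bool \<times> bool \<Rightarrow> 'x \<Rightarrow> 'x" and h :: "'x \<Rightarrow> real"
  assumes inverse: "\<And>e b x. step (e, \<not> b) (step (e, b) x) = x"
    and down: "\<And>x s s'. s \<noteq> s' \<Longrightarrow> h (step s x) < h x \<Longrightarrow> h x < h (step s' x)"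
    and level: "\<And>x s1 s2 s3. distinct [s1, s2, s3] \<Longrightarrow>
      h x < h (step s1 x) \<or> h x < h (step s2 x) \<or> h x < h (step s3 x)"
    and E: "E \<noteq> {}" "\<And>s x. x \<in> E \<Longrightarrow> step s x \<in> E"
    and G: "id \<in> G" "\<And>e. step (e, True) \<in> G"
  shows "paradoxical G 4 E"
proof -
  \<comment> \<open>By \<open>level\<close> a point has at most two non-rising directions, so
    exchanging them is an involution. The default \<open>s\<close> covers rising directions and a
    non-rising one without partner.\<close>
  define other where "other = (\<lambda>x s. if h (step s x) \<le> h x \<and> (\<exists>s'. s' \<noteq> s \<and> h (step s' x) \<le> h x)
    then SOME s'. s' \<noteq> s \<and> h (step s' x) \<le> h x else s)"
  have other: "other x s = s'" if "s' \<noteq> s" "h (step s x) \<le> h x" "h (step s' x) \<le> h x" for x s s'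
  proof -
    have "(SOME s'. s' \<noteq> s \<and> h (step s' x) \<le> h x) = s'"
    proof (rule some_equality)
      fix s'' assume "s'' \<noteq> s \<and> h (step s'' x) \<le> h x"
      then show "s'' = s'" using that level[of s s' s'' x] by force
    qed (use that in blast)
    then show ?thesis using that unfolding other_def by metis
  qed
  have other_other: "other x (other x s) = s" for x s
  proof (cases "h (step s x) \<le> h x \<and> (\<exists>s'. s' \<noteq> s \<and> h (step s' x) \<le> h x)")
    case True
    then show ?thesis by (metis other)
  qed (auto simp: other_def)
  \<comment> \<open>On darts, that is vertices with an outgoing direction, \<open>\<rho>\<close>
    reverses a dart and \<open>\<sigma>\<close> passes to the other non-rising dart at the same
    vertex.\<close>
  define \<rho> where "\<rho> = (\<lambda>(x, (e, b)). (step (e, b) x, (e, \<not> b)))"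
  define \<sigma> where "\<sigma> = (\<lambda>(x, s). (x, other x s))"
  have "\<exists>C. \<forall>d. (\<rho> d \<in> C \<longleftrightarrow> d \<notin> C) \<and> (\<sigma> d \<noteq> d \<longrightarrow> (\<sigma> d \<in> C \<longleftrightarrow> d \<notin> C))"
    by (rule involutions_colouring) (auto simp: \<rho>_def \<sigma>_def inverse other_other)
  then obtain C where C: "\<And>d. (\<rho> d \<in> C \<longleftrightarrow> d \<notin> C) \<and> (\<sigma> d \<noteq> d \<longrightarrow> (\<sigma> d \<in> C \<longleftrightarrow> d \<notin> C))" by blast
  have C\<rho>: "(step (e, b) x, (e, \<not> b)) \<in> C \<longleftrightarrow> (x, (e, b)) \<notin> C" for x e b
    using C[of "(x, (e, b))"] by (simp add: \<rho>_def)
  have C\<sigma>: "(x, s') \<in> C \<longleftrightarrow> (x, s) \<notin> C"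
    if "s' \<noteq> s" "h (step s x) \<le> h x" "h (step s' x) \<le> h x" for x s s'
    using C[of "(x, s)"] other[OF that] that(1) by (simp add: \<sigma>_def)
  \<comment> \<open>Each edge has exactly one dart in \<open>D\<close>, the one at its upper end,
    ties being decided by the colouring. A vertex carries at most one: \<open>down\<close> excludes
    a second if one falls, the colouring if both are level.\<close>
  define D where "D = {(x, s). h (step s x) < h x \<or> h (step s x) = h x \<and> (x, s) \<in> C}"
  have D\<rho>: "(step (e, b) x, (e, \<not> b)) \<in> D \<longleftrightarrow> (x, (e, b)) \<notin> D" for x e b
    using C\<rho>[of e b x] by (auto simp: D_def inverse)
  have D_unique: "s = s'" if "(x, s) \<in> D" "(x, s') \<in> D" for x s s'
    using that down[of s s' x] down[of s' s x] C\<sigma>[of s' s x]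
    by (cases "s = s'") (auto simp: D_def)
  define j where "j = (\<lambda>(x, e). if (x, (e, False)) \<in> D then x else step (e, False) x)"
  have "inj j"
  proof (rule injI)
    have dart: "(j (x, e), (e, (x, (e, False)) \<notin> D)) \<in> D" for x e
      using D\<rho>[of e False x] by (auto simp: j_def)
    fix d d' assume eq: "j d = j d'"
    obtain x e x' e' where d: "d = (x, e)" "d' = (x', e')" by fastforce
    then have "(e, (x, (e, False)) \<notin> D) = (e', (x', (e', False)) \<notin> D)"
      using dart eq D_unique by metis
    then have "e = e'" "(x, (e, False)) \<in> D \<longleftrightarrow> (x', (e', False)) \<in> D" by auto
    then have "x = x' \<or> step (e, False) x = step (e, False) x'"
      using eq by (cases "(x, (e, False)) \<in> D") (simp_all add: d j_def)
    then have "x = x'" using inverse[of e False x] inverse[of e False x'] by metis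
    then show "d = d'" using \<open>e = e'\<close> d by simp
  qed
  have "\<exists>s. h x < h (step s x)" for x
    using level[of "(True, True)" "(True, False)" "(False, True)" x] by auto
  then obtain up where up: "\<And>x. h x < h (step (up x) x)" by metis
  \<comment> \<open>An edge is named by the end from which its label is traversed backwards, so a
    rising step \<open>(e, True)\<close> is named by its target.\<close>
  define i where "i = (\<lambda>x. (if snd (up x) then step (up x) x else x, fst (up x)))"
  have "inj i"
  proof (rule injI)
    \<comment> \<open>An edge cannot rise from both of its ends.\<close>
    have opposite: False
      if "i x = i y" "up x = (e, True)" "up y = (e', False)" for x y e e'
    proof -
      have "y = step (e, True) x" "e' = e" using that by (auto simp: i_def)
      then have "step (up y) y = x" "step (up x) x = y" using that inverse[of e True x] by simp_all
      then show False using up[of x] up[of y] by simp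
    qed
    fix x y assume eq: "i x = i y"
    obtain e b where x: "up x = (e, b)" by fastforce
    obtain e' b' where y: "up y = (e', b')" by fastforce
    have "b = b'" using opposite[OF eq] opposite[OF eq[symmetric]] x y by (cases b; cases b') auto
    moreover have "e = e'" using eq x y by (simp add: i_def)
    ultimately have "x = y \<or> step (e, True) x = step (e, True) y"
      using eq x y by (cases b) (simp_all add: i_def)
    then show "x = y" using inverse[of e True x] inverse[of e True y] by metis
  qed
  then obtain \<phi> where \<phi>: "bij \<phi>" and \<phi>_cases: "\<And>e. \<phi> e = j e \<or> i (\<phi> e) = e"
    using injections_common_bijection[OF _ \<open>inj j\<close>] by blast
  have incident: "\<phi> (x, e) = x \<or> \<phi> (x, e) = step (e, False) x" for x e
  proof (cases "\<phi> (x, e) = j (x, e)")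
    case True
    then show ?thesis by (simp add: j_def)
  next
    case False
    then have "i (\<phi> (x, e)) = (x, e)" using \<phi>_cases by blast
    then have "x = \<phi> (x, e) \<or> x = step (e, True) (\<phi> (x, e))"
      by (cases "up (\<phi> (x, e))") (simp add: i_def split: if_splits)
    then show ?thesis using inverse[of e True "\<phi> (x, e)"] by (metis (full_types))
  qed
  \<comment> \<open>The vertices matched with edges labelled \<open>e\<close>. If
    \<open>(x, e)\<close> is matched with \<open>x\<close>, that vertex stays in place; if with
    \<open>step (e, False) x\<close>, then \<open>step (e, True)\<close> brings it back to
    \<open>x\<close>.\<close>
  define V where "V = (\<lambda>e. \<phi> ` (E \<times> {e}))"
  have inj\<phi>: "p = p'" if "\<phi> p = \<phi> p'" for p p' using \<phi> that by (blast dest: bij_is_inj injD)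
  have \<phi>_in: "\<phi> (x, e) \<in> E \<longleftrightarrow> x \<in> E" for x e
    using incident[of x e] E(2) inverse[of e False x] by metis
  have decomp: "equidecomposable G 2 (V e) E" for e
  proof (rule equidecomposable_two_pieces[OF G(1) G(2)[of e]])
    define A where "A = {x \<in> E. \<phi> (x, e) = x}"
    define B where "B = step (e, False) ` {x \<in> E. \<phi> (x, e) \<noteq> x}"
    have B: "step (e, True) ` B = {x \<in> E. \<phi> (x, e) \<noteq> x}"
      using inverse[of e False] by (simp add: B_def image_image)
    have "z \<notin> B" if "z \<in> A" for z
    proof
      assume "z \<in> B"
      then obtain x where "z = step (e, False) x" "\<phi> (x, e) \<noteq> x" by (auto simp: B_def)
      then have "\<phi> (x, e) = \<phi> (z, e)" using incident[of x e] that by (auto simp: A_def)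
      then show False using inj\<phi> \<open>\<phi> (x, e) \<noteq> x\<close> that by (auto simp: A_def)
    qed
    then show "A \<inter> B = {}" by blast
    show "A \<inter> step (e, True) ` B = {}" "A \<union> step (e, True) ` B = E" by (auto simp: A_def B)
    have "V e = (\<lambda>x. \<phi> (x, e)) ` E" by (auto simp: V_def)
    also have "\<dots> = (\<lambda>x. \<phi> (x, e)) ` {x \<in> E. \<phi> (x, e) = x} \<union> (\<lambda>x. \<phi> (x, e)) ` {x \<in> E. \<phi> (x, e) \<noteq> x}"
      by blast
    also have "(\<lambda>x. \<phi> (x, e)) ` {x \<in> E. \<phi> (x, e) = x} = A" by (auto simp: A_def)
    also have "(\<lambda>x. \<phi> (x, e)) ` {x \<in> E. \<phi> (x, e) \<noteq> x} = B"
      unfolding B_def by (rule image_cong) (use incident in auto)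
    finally show "A \<union> B = V e" by simp
  qed
  have "V True \<union> V False = E"
  proof
    show "V True \<union> V False \<subseteq> E" by (auto simp: V_def \<phi>_in)
    show "E \<subseteq> V True \<union> V False"
    proof
      fix y assume "y \<in> E"
      moreover obtain x e where "y = \<phi> (x, e)" using \<phi> by (metis bij_pointE surj_pair)
      ultimately show "y \<in> V True \<union> V False" using \<phi>_in by (cases e) (auto simp: V_def)
    qed
  qed
  moreover have "V True \<inter> V False = {}" using inj\<phi> by (fastforce simp: V_def)
  moreover have "(1::nat) \<le> 2" "(2::nat) + 2 = 4" by simp_all
  ultimately show ?thesis unfolding paradoxical_def using E(1) decomp by blast
qed

subsection \<open>Seminorms expanding a small element\<close>

text \<open>Modulo a maximal \<open>R\<close>-submodule \<open>W\<close> meeting \<open>R\<close>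
  only in 0, every field element becomes a fraction \<open>q / r\<close> over \<open>R\<close>. This
  is an \<open>R\<close>-linear projection onto the fraction field, where \<open>N\<close> extends
  as \<open>N q / N r\<close>.\<close>

lemma subring_seminorm_extension:
  fixes R :: "'a::field set" and N :: "'a \<Rightarrow> real"
  assumes R1: "1 \<in> R" and Radd: "\<And>x y. x \<in> R \<Longrightarrow> y \<in> R \<Longrightarrow> x + y \<in> R"
    and Rneg: "\<And>x. x \<in> R \<Longrightarrow> - x \<in> R"
    and Rmult: "\<And>x y. x \<in> R \<Longrightarrow> y \<in> R \<Longrightarrow> x * y \<in> R"
    and N0: "\<And>x. x \<in> R \<Longrightarrow> N x = 0 \<longleftrightarrow> x = 0" and Npos: "\<And>x. x \<in> R \<Longrightarrow> 0 \<le> N x"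
    and Nadd: "\<And>x y. x \<in> R \<Longrightarrow> y \<in> R \<Longrightarrow> N (x + y) \<le> N x + N y"
    and Nmult: "\<And>x y. x \<in> R \<Longrightarrow> y \<in> R \<Longrightarrow> N (x * y) = N x * N y"
  shows "\<exists>\<nu>::'a \<Rightarrow> real. \<nu> 1 = 1 \<and> (\<forall>x. 0 \<le> \<nu> x) \<and> (\<forall>x y. \<nu> (x + y) \<le> \<nu> x + \<nu> y) \<and>
    (\<forall>r x. r \<in> R \<longrightarrow> \<nu> (r * x) = N r * \<nu> x)"
proof -
  have R0: "0 \<in> R" using Radd[OF R1 Rneg[OF R1]] by simp
  define \<W> where "\<W> = {W. 0 \<in> W \<and> (\<forall>x\<in>W. \<forall>y\<in>W. x + y \<in> W) \<and> (\<forall>r\<in>R. \<forall>x\<in>W. r * x \<in> W) \<and> W \<inter> R \<subseteq> {0}}"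
  have "\<exists>M\<in>\<W>. \<forall>X\<in>\<W>. M \<subseteq> X \<longrightarrow> X = M"
  proof (rule subset_Zorn_nonempty)
    have "{0} \<in> \<W>" by (auto simp: \<W>_def)
    then show "\<W> \<noteq> {}" by blast
  next
    fix C assume C: "C \<noteq> {}" "subset.chain \<W> C"
    then have mem: "W \<in> \<W>" if "W \<in> C" for W using that by (auto simp: subset.chain_def)
    have "x + y \<in> \<Union>C" if "x \<in> \<Union>C" "y \<in> \<Union>C" for x y
    proof -
      from that obtain U V where "U \<in> C" "x \<in> U" "V \<in> C" "y \<in> V" by blast
      moreover have "U \<subseteq> V \<or> V \<subseteq> U" using C calculation by (auto simp: subset_chain_def)
      ultimately obtain W where "W \<in> C" "x \<in> W" "y \<in> W" by blast
      then have "x + y \<in> W" using mem[of W] by (auto simp: \<W>_def)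
      then show ?thesis using \<open>W \<in> C\<close> by blast
    qed
    moreover have "0 \<in> \<Union>C" using C(1) mem by (auto simp: \<W>_def)
    moreover have "r * x \<in> \<Union>C" if "r \<in> R" "x \<in> \<Union>C" for r x
      using that mem unfolding \<W>_def by blast
    moreover have "\<Union>C \<inter> R \<subseteq> {0}" using mem unfolding \<W>_def by blast
    ultimately show "\<Union>C \<in> \<W>" unfolding \<W>_def by blast
  qed
  then obtain W where W: "W \<in> \<W>" and max: "\<And>X. X \<in> \<W> \<Longrightarrow> W \<subseteq> X \<Longrightarrow> X = W" by blast
  have W0: "0 \<in> W" and Wadd: "\<And>x y. x \<in> W \<Longrightarrow> y \<in> W \<Longrightarrow> x + y \<in> W"
    and Wmult: "\<And>r x. r \<in> R \<Longrightarrow> x \<in> W \<Longrightarrow> r * x \<in> W"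
    and WR: "\<And>x. x \<in> W \<Longrightarrow> x \<in> R \<Longrightarrow> x = 0"
    using W by (auto simp: \<W>_def)
  have Wneg: "- x \<in> W" if "x \<in> W" for x using Wmult[OF Rneg[OF R1] that] by simp
  have Wdiff: "x - y \<in> W" if "x \<in> W" "y \<in> W" for x y using Wadd[OF that(1) Wneg[OF that(2)]] by simp
  define rep where "rep = (\<lambda>x p. fst p \<in> R \<and> fst p \<noteq> 0 \<and> snd p \<in> R \<and> fst p * x - snd p \<in> W)"
  have ex: "\<exists>p. rep x p" for x
  proof (cases "x \<in> W")
    case True
    then show ?thesis using R1 R0 by (intro exI[of _ "(1, 0)"]) (simp add: rep_def)
  next
    case False
    \<comment> \<open>By maximality, adjoining \<open>x\<close> to \<open>W\<close> must produce a
      nonzero element \<open>w + r * x\<close> of \<open>R\<close>; here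
      \<open>r \<noteq> 0\<close>, since otherwise \<open>w\<close> would lie in both
      \<open>W\<close> and \<open>R\<close>.\<close>
    define X where "X = {w + r * x | w r. w \<in> W \<and> r \<in> R}"
    have "W \<subseteq> X" using R0 by (force simp: X_def)
    have "x \<in> X" using W0 R1 by (force simp: X_def)
    then have "X \<notin> \<W>" using max \<open>W \<subseteq> X\<close> False by blast
    moreover have "0 \<in> X" using \<open>W \<subseteq> X\<close> W0 by blast
    moreover have "y + z \<in> X" if "y \<in> X" "z \<in> X" for y z
    proof -
      from that obtain w r w' r' where "y = w + r * x" "z = w' + r' * x"
        "w \<in> W" "r \<in> R" "w' \<in> W" "r' \<in> R" by (auto simp: X_def)
      moreover from this have "y + z = (w + w') + (r + r') * x" by (simp add: algebra_simps)
      ultimately show ?thesis using Wadd Radd unfolding X_def by blast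
    qed
    moreover have "s * y \<in> X" if "s \<in> R" "y \<in> X" for s y
    proof -
      from that obtain w r where "y = w + r * x" "w \<in> W" "r \<in> R" by (auto simp: X_def)
      moreover from this have "s * y = s * w + (s * r) * x" by (simp add: algebra_simps)
      ultimately show ?thesis using Wmult Rmult that unfolding X_def by blast
    qed
    ultimately have "\<not> X \<inter> R \<subseteq> {0}" unfolding \<W>_def by blast
    then obtain w r where "w \<in> W" "r \<in> R" "w + r * x \<in> R" "w + r * x \<noteq> 0" by (auto simp: X_def)
    moreover have "r \<noteq> 0" using calculation WR by auto
    ultimately have "rep x (r, w + r * x)" using Wneg by (simp add: rep_def)
    then show ?thesis by blast
  qed
  define \<nu> where "\<nu> = (\<lambda>x. let p = SOME p. rep x p in N (snd p) / N (fst p))"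
  have \<nu>: "\<nu> x = N q / N r" if "rep x (r, q)" for x r q
  proof -
    obtain r' q' where p: "(SOME p. rep x p) = (r', q')" by fastforce
    have "rep x (r', q')" using someI_ex[OF ex[of x]] p by simp
    note rr = this that
    \<comment> \<open>Cross-multiplication eliminates \<open>x\<close> and leaves an element of
      \<open>W\<close> and \<open>R\<close>, hence 0: the quotient does not depend on the
      representative.\<close>
    have "r * (r' * x - q') - r' * (r * x - q) \<in> W" using rr Wdiff Wmult by (simp add: rep_def)
    then have "r' * q - r * q' \<in> W" by (simp add: algebra_simps)
    moreover have "r' * q - r * q' \<in> R"
      using rr Rmult Radd[OF _ Rneg] by (fastforce simp: rep_def)
    ultimately have "r' * q = r * q'" using WR by fastforce
    then have "N r' * N q = N r * N q'" using rr Nmult by (metis fst_conv rep_def snd_conv)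
    moreover have "N r \<noteq> 0" "N r' \<noteq> 0" using rr N0 by (auto simp: rep_def)
    ultimately show ?thesis unfolding \<nu>_def p by (simp add: field_simps)
  qed
  have N1: "N 1 = 1" using Nmult[OF R1 R1] N0[OF R1] by simp
  have "\<nu> 1 = 1" using \<nu>[of 1 1 1] R1 W0 by (simp add: rep_def N1)
  moreover have "0 \<le> \<nu> x" for x
  proof -
    obtain r q where "rep x (r, q)" using ex[of x] by auto
    then show ?thesis using \<nu> Npos by (simp add: rep_def)
  qed
  moreover have "\<nu> (x + y) \<le> \<nu> x + \<nu> y" for x y
  proof -
    obtain r q where x: "rep x (r, q)" using ex[of x] by auto
    obtain r' q' where y: "rep y (r', q')" using ex[of y] by auto
    have "r' * (r * x - q) + r * (r' * y - q') \<in> W" using x y Wadd Wmult by (simp add: rep_def)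
    then have "rep (x + y) (r * r', r' * q + r * q')"
      using x y Radd Rmult by (simp add: rep_def algebra_simps)
    then have "\<nu> (x + y) = N (r' * q + r * q') / N (r * r')" by (rule \<nu>)
    also have "\<dots> \<le> (N r' * N q + N r * N q') / (N r * N r')"
      using x y Nadd[of "r' * q" "r * q'"] Rmult Nmult Npos
      by (auto simp: rep_def intro!: divide_right_mono mult_nonneg_nonneg)
    also have "\<dots> = \<nu> x + \<nu> y" using \<nu>[OF x] \<nu>[OF y] x y N0
      by (simp add: rep_def field_simps)
    finally show ?thesis .
  qed
  moreover have "\<nu> (s * x) = N s * \<nu> x" if "s \<in> R" for s x
  proof -
    obtain r q where x: "rep x (r, q)" using ex[of x] by auto
    have "s * (r * x - q) \<in> W" using that x Wmult by (simp add: rep_def)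
    then have "rep (s * x) (r, s * q)" using x that Rmult by (simp add: rep_def algebra_simps)
    then have "\<nu> (s * x) = N (s * q) / N r" by (rule \<nu>)
    then show ?thesis using \<nu>[OF x] x that Nmult by (simp add: rep_def)
  qed
  ultimately show ?thesis by blast
qed

text \<open>Homogeneity is asked for the scalars \<open>t\<close> and \<open>-1\<close>, which
  generate the coefficients of the maps used below; \<open>\<nu> 1 = 1\<close> then gives
  \<open>\<nu> t = T\<close>.\<close>

definition expanding_seminorm :: "'a::ring_1 \<Rightarrow> real \<Rightarrow> ('a \<Rightarrow> real) \<Rightarrow> bool" where
  "expanding_seminorm t T \<nu> \<longleftrightarrow> \<nu> 1 = 1 \<and> (\<forall>x. 0 \<le> \<nu> x) \<and> (\<forall>x y. \<nu> (x + y) \<le> \<nu> x + \<nu> y) \<and>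
     (\<forall>x. \<nu> (- x) = \<nu> x) \<and> (\<forall>x. \<nu> (t * x) = T * \<nu> x)"

section \<open>Existence of expanding seminorms\<close>

context nonarch_valuation
begin

lemma v_1: "v 1 = 1"
  using v_mult[of 1 1] v_eq_0_iff[of 1] by simp

lemma v_0: "v 0 = 0"
  using v_eq_0_iff by simp

lemma v_minus: "v (- x) = v x"
proof -
  have "v (- 1) * v (- 1) = 1" using v_mult[of "-1" "-1"] v_1 by simp
  then have "v (- 1) = 1" using v_nonneg[of "-1"] by (metis abs_of_nonneg abs_1 real_sqrt_abs2 real_sqrt_one)
  then show ?thesis using v_mult[of "-1" x] by simp
qed

lemma v_power: "v (x ^ n) = v x ^ n"
  by (induction n) (simp_all add: v_1 v_mult)

lemma v_inverse: "v (inverse x) = inverse (v x)"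
proof (cases "x = 0")
  case False
  then have "v x * v (inverse x) = 1" using v_mult[of x "inverse x"] v_1 by simp
  then show ?thesis by (metis inverse_unique)
qed (simp add: v_0)

lemma v_of_int_le_1: "v (of_int m) \<le> 1"
proof (induction m rule: int_induct[where k = 0])
  case base
  then show ?case by (simp add: v_0)
next
  case (step1 i)
  then show ?case using v_add_le[of "of_int i" 1] by (simp add: v_1)
next
  case (step2 i)
  then show ?case using v_add_le[of "of_int i" "-1"] by (simp add: v_1 v_minus)
qed

text \<open>The usual absolute value on the integers is extended to the field; a high power of
  \<open>m\<close> is small for \<open>v\<close> and large for the extension.\<close>

lemma expanding_seminorm_exists_integer:
  assumes m: "of_int m \<noteq> (0::'a)" "v (of_int m) < 1" and "0 < \<delta>"
  shows "\<exists>t T \<nu>. v t < \<delta> \<and> C \<le> T \<and> expanding_seminorm t T \<nu>"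
proof -
  have vm: "0 < v (of_int m)" using m v_nonneg v_eq_0_iff by (metis less_eq_real_def)
  \<comment> \<open>In positive characteristic the powers of \<open>m\<close> would take finitely
    many values, whereas those of \<open>v (of_int m)\<close> strictly decrease.\<close>
  have char0: "n = 0" if "of_int n = (0::'a)" for n
  proof (rule ccontr)
    assume "n \<noteq> 0"
    have "range (\<lambda>k::nat. m ^ k mod \<bar>n\<bar>) \<subseteq> {0..<\<bar>n\<bar>}" using \<open>n \<noteq> 0\<close> by auto
    then have "finite (range (\<lambda>k::nat. m ^ k mod \<bar>n\<bar>))" by (rule finite_subset) simp
    then have "\<not> inj (\<lambda>k::nat. m ^ k mod \<bar>n\<bar>)" using finite_imageD infinite_UNIV_nat by blast
    then obtain i j :: nat where ij: "i \<noteq> j" "m ^ i mod \<bar>n\<bar> = m ^ j mod \<bar>n\<bar>" by (auto simp: inj_def)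
    then have "n dvd m ^ i - m ^ j" by (metis abs_dvd_iff mod_eq_dvd_iff)
    then obtain k where "m ^ i - m ^ j = n * k" by blast
    then have "of_int (m ^ i) - of_int (m ^ j) = (of_int n * of_int k :: 'a)"
      by (metis of_int_diff of_int_mult)
    then have "of_int m ^ i = (of_int m ^ j :: 'a)" using that by simp
    then have "v (of_int m) ^ i = v (of_int m) ^ j" by (metis v_power)
    then show False using ij vm m by (metis linorder_neqE_nat power_strict_decreasing less_irrefl)
  qed
  then have inj: "inj (of_int :: int \<Rightarrow> 'a)" by (intro injI) (metis of_int_diff eq_iff_diff_eq_0)
  define N where "N = (\<lambda>x::'a. \<bar>real_of_int (inv of_int x)\<bar>)"
  have N: "N (of_int k) = \<bar>real_of_int k\<bar>" for k using inj by (simp add: N_def)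
  have "\<exists>\<nu>::'a \<Rightarrow> real. \<nu> 1 = 1 \<and> (\<forall>x. 0 \<le> \<nu> x) \<and> (\<forall>x y. \<nu> (x + y) \<le> \<nu> x + \<nu> y) \<and>
    (\<forall>r x. r \<in> \<int> \<longrightarrow> \<nu> (r * x) = N r * \<nu> x)"
  proof (rule subring_seminorm_extension)
    show "N x = 0 \<longleftrightarrow> x = 0" "0 \<le> N x" if "x \<in> \<int>" for x
    proof -
      from that obtain k where k: "x = of_int k" by (auto elim!: Ints_cases)
      show "N x = 0 \<longleftrightarrow> x = 0" "0 \<le> N x" using char0[of k] by (auto simp: k N simp del: of_int_0_eq_iff)
    qed
    show "N (x + y) \<le> N x + N y" "N (x * y) = N x * N y" if "x \<in> \<int>" "y \<in> \<int>" for x y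
    proof -
      from that obtain k l where "x = of_int k" "y = of_int l" by (auto elim!: Ints_cases)
      then show "N (x + y) \<le> N x + N y" "N (x * y) = N x * N y"
        using N[of "k + l"] N[of "k * l"] by (simp_all add: N abs_mult)
    qed
  qed auto
  then obtain \<nu> where \<nu>: "\<nu> 1 = 1" "\<And>x. 0 \<le> \<nu> x" "\<And>x y. \<nu> (x + y) \<le> \<nu> x + \<nu> y"
    "\<And>r x. r \<in> \<int> \<Longrightarrow> \<nu> (r * x) = N r * \<nu> x" by metis
  have m2: "\<bar>real_of_int m\<bar> \<ge> 2"
  proof -
    have "m \<noteq> 0" "m \<noteq> 1" "m \<noteq> -1" using m v_1 v_minus[of 1] by auto
    then have "\<bar>m\<bar> \<ge> 2" by linarith
    then show ?thesis by linarith
  qed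
  obtain k1 where k1: "v (of_int m) ^ k1 < \<delta>" using real_arch_pow_inv m(2) \<open>0 < \<delta>\<close> by blast
  obtain k2 where k2: "C < \<bar>real_of_int m\<bar> ^ k2" using real_arch_pow m2 by (meson le_less_trans one_less_numeral_iff order_less_le_trans semiring_norm(76))
  \<comment> \<open>\<open>k1\<close> makes the valuation small, \<open>k2\<close> makes the factor
    large, and both effects persist for larger exponents.\<close>
  define k where "k = max k1 k2"
  have "v (of_int (m ^ k)) < \<delta>"
    using k1 power_decreasing[of k1 k "v (of_int m)"] vm m(2) unfolding v_power of_int_power k_def by linarith
  moreover have "C \<le> \<bar>real_of_int m\<bar> ^ k"
    using k2 power_increasing[of k2 k "\<bar>real_of_int m\<bar>"] m2 unfolding k_def by linarith
  moreover have "\<nu> (of_int (m ^ k) * x) = \<bar>real_of_int m\<bar> ^ k * \<nu> x" for x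
    using \<nu>(4)[of "of_int (m ^ k)" x] by (simp only: N) (simp add: power_abs)
  moreover have "\<nu> (- x) = \<nu> x" for x
    using \<nu>(4)[of "of_int (-1)" x] by (simp only: N) simp
  ultimately show ?thesis using \<nu>(1-3) unfolding expanding_seminorm_def by blast
qed

text \<open>Here \<open>t\<close> satisfies no nontrivial polynomial relation with integer
  coefficients, so the degree gives a multiplicative size \<open>T ^ degree\<close> on the
  polynomials in \<open>t\<close>, in any characteristic.\<close>

lemma expanding_seminorm_exists_transcendental:
  assumes triv: "\<And>m. of_int m \<noteq> (0::'a) \<Longrightarrow> v (of_int m) = 1"
    and t: "t \<noteq> 0" "v t < 1" and T: "1 \<le> T"
  shows "\<exists>\<nu>. expanding_seminorm t T \<nu>"
proof -
  define P where "P = {p::'a poly. \<forall>i. coeff p i \<in> \<int>}"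
  have P_pCons: "pCons c p \<in> P \<longleftrightarrow> c \<in> \<int> \<and> p \<in> P" for c p
    by (auto simp: P_def coeff_pCons split: nat.splits)
  have P_add: "p + q \<in> P" and P_mult: "p * q \<in> P" if "p \<in> P" "q \<in> P" for p q
    using that by (auto simp: P_def coeff_mult intro!: Ints_sum)
  have P_neg: "- p \<in> P" if "p \<in> P" for p using that by (auto simp: P_def)
  have P_1: "1 \<in> P" and P_X: "[:0, 1:] \<in> P"
    by (auto simp: P_def coeff_pCons one_pCons split: nat.splits)
  have v_le: "v (poly p t) \<le> 1" if "p \<in> P" for p
    using that
  proof (induction p)
    case (pCons c p)
    then have "v c \<le> 1" "v (poly p t) \<le> 1" using v_of_int_le_1 by (auto simp: P_pCons elim!: Ints_cases)
    then have "v (t * poly p t) \<le> 1" using t(2) v_nonneg by (auto simp: v_mult intro!: mult_le_one)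
    then show ?case using v_add_le[of c "t * poly p t"] \<open>v c \<le> 1\<close> by simp
  qed (simp add: v_0)
  have root: "p = 0" if "p \<in> P" "poly p t = 0" for p
    using that
  proof (induction p)
    case (pCons c p)
    then have "v (poly p t) \<le> 1" and c: "c \<in> \<int>" and "p \<in> P" using v_le by (auto simp: P_pCons)
    \<comment> \<open>In a relation the constant term is minus \<open>t\<close> times an element of
      value at most 1, so it vanishes by \<open>triv\<close>; after division by \<open>t\<close> the
      induction applies.\<close>
    have "v c = v (t * poly p t)"
      using pCons.prems(2) v_minus[of c] by (simp add: add_eq_0_iff)
    also have "\<dots> < 1" using \<open>v (poly p t) \<le> 1\<close> t(2) v_nonneg
      by (metis mult_left_le order_le_less_trans v_mult)
    finally have "c = 0" using triv c by (metis Ints_cases less_irrefl)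
    then show ?case using pCons t \<open>p \<in> P\<close> by simp
  qed simp
  have inj: "inj_on (\<lambda>p. poly p t) P"
  proof (rule inj_onI)
    fix p q assume "p \<in> P" "q \<in> P" "poly p t = poly q t"
    then show "p = q" using root[of "p + - q"] P_add[of p "- q"] P_neg by simp
  qed
  \<comment> \<open>The zero polynomial needs its own value because
    \<open>degree 0 = 0\<close>.\<close>
  define M where "M = (\<lambda>p::'a poly. if p = 0 then 0 else T ^ degree p)"
  define N where "N = (\<lambda>x. M (inv_into P (\<lambda>p. poly p t) x))"
  have N: "N (poly p t) = M p" if "p \<in> P" for p
    using inv_into_f_f[OF inj that] by (simp add: N_def)
  have M_pos: "0 \<le> M p" for p using T by (simp add: M_def)
  have M_mult: "M (p * q) = M p * M q" for p q by (simp add: M_def degree_mult_eq power_add)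
  have M_add: "M (p + q) \<le> M p + M q" for p q
  proof (cases "p = 0 \<or> q = 0 \<or> p + q = 0")
    case False
    have "T ^ degree (p + q) \<le> T ^ max (degree p) (degree q)"
      using degree_add_le_max T by (rule power_increasing)
    also have "\<dots> \<le> T ^ degree p + T ^ degree q" using T by (simp add: max_def)
    finally show ?thesis using False by (simp add: M_def)
  qed (use M_pos in \<open>auto simp: M_def\<close>)
  let ?R = "(\<lambda>p. poly p t) ` P"
  have "\<exists>\<nu>::'a \<Rightarrow> real. \<nu> 1 = 1 \<and> (\<forall>x. 0 \<le> \<nu> x) \<and> (\<forall>x y. \<nu> (x + y) \<le> \<nu> x + \<nu> y) \<and>
    (\<forall>r x. r \<in> ?R \<longrightarrow> \<nu> (r * x) = N r * \<nu> x)"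
  proof (rule subring_seminorm_extension)
    show "1 \<in> ?R" using P_1 by (force intro: image_eqI[of _ _ 1])
    show "- x \<in> ?R" if "x \<in> ?R" for x using that P_neg by (force simp flip: poly_minus)
    show "N x = 0 \<longleftrightarrow> x = 0" "0 \<le> N x" if "x \<in> ?R" for x
    proof -
      from that obtain p where "p \<in> P" "x = poly p t" by blast
      then show "N x = 0 \<longleftrightarrow> x = 0" "0 \<le> N x" using root[of p] N[of p] M_pos[of p] T by (auto simp: M_def)
    qed
    fix x y assume "x \<in> ?R" "y \<in> ?R"
    then obtain p q where "x = poly p t" "y = poly q t" "p \<in> P" "q \<in> P" by blast
    then show "x + y \<in> ?R" "x * y \<in> ?R" "N (x + y) \<le> N x + N y" "N (x * y) = N x * N y"
      using P_add[of p q] P_mult[of p q] M_add M_mult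
      by (auto simp: N simp flip: poly_add poly_mult)
  qed
  then obtain \<nu> where \<nu>: "\<nu> 1 = 1" "\<And>x. 0 \<le> \<nu> x" "\<And>x y. \<nu> (x + y) \<le> \<nu> x + \<nu> y"
    "\<And>p x. p \<in> P \<Longrightarrow> \<nu> (poly p t * x) = M p * \<nu> x" using N by (metis image_eqI)
  have "\<nu> (t * x) = T * \<nu> x" for x using \<nu>(4)[OF P_X, of x] by (simp add: M_def)
  moreover have "\<nu> (- x) = \<nu> x" for x using \<nu>(4)[OF P_neg[OF P_1], of x] by (simp add: M_def)
  ultimately show ?thesis using \<nu>(1-3) unfolding expanding_seminorm_def by blast
qed

text \<open>Either some integer has value strictly between 0 and 1, or all integers that are nonzero
  in the field have value 1; each case has its construction.\<close>

lemma expanding_seminorm_exists: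
  assumes "nontrivial_valuation v" "0 < \<delta>" "1 \<le> C"
  shows "\<exists>t T \<nu>. v t < \<delta> \<and> C \<le> T \<and> expanding_seminorm t T \<nu>"
proof (cases "\<exists>m. of_int m \<noteq> (0::'a) \<and> v (of_int m) \<noteq> 1")
  case True
  then show ?thesis
    using expanding_seminorm_exists_integer assms(2) v_of_int_le_1 by (metis less_eq_real_def)
next
  case False
  have "v 1 \<in> {v x | x. x \<noteq> 0}" by (metis (mono_tags, lifting) mem_Collect_eq zero_neq_one)
  then obtain x where x: "x \<noteq> 0" "v x \<noteq> 1"
    using assms(1) v_1 unfolding nontrivial_valuation_def by auto
  obtain s where s: "s \<noteq> 0" "v s < 1"
  proof (cases "v x < 1")
    case False
    then have "v (inverse x) < 1" using x by (simp only: v_inverse) (simp add: inverse_less_1_iff)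
    then show ?thesis using that x by (metis nonzero_imp_inverse_nonzero)
  qed (use x that in blast)
  then obtain k where k: "v s ^ k < \<delta>" using real_arch_pow_inv assms(2) by blast
  \<comment> \<open>\<open>Suc k\<close> keeps the exponent positive, so the value is below 1 even
    for \<open>k = 0\<close>.\<close>
  have "v (s ^ Suc k) < \<delta>"
    using k s power_decreasing[of k "Suc k" "v s"] v_nonneg by (simp only: v_power) force
  moreover have "v (s ^ Suc k) < 1" using s v_nonneg power_le_one[of "v s" k] mult_left_le[of "v s ^ k" "v s"]
    by (simp add: v_mult v_power)
  ultimately show ?thesis
    using expanding_seminorm_exists_transcendental[of "s ^ Suc k" C] False s assms(3)
    by (metis order_refl power_not_zero)
qed

end

subsection \<open>Four strips in the plane\<close>

text \<open>Truncation at 2 flattens the region where two strips meet: no step falls from height 2,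
  so two level directions do no harm there.\<close>

definition height :: "('a \<Rightarrow> real) \<Rightarrow> 'a \<Rightarrow> 'a \<Rightarrow> real" where
  "height \<nu> x y = max 2 (max (\<nu> x) (\<nu> y))"

lemma height_ge: "2 \<le> height \<nu> x y" "\<nu> x \<le> height \<nu> x y" "\<nu> y \<le> height \<nu> x y"
  by (auto simp: height_def)

lemma height_commute: "height \<nu> x y = height \<nu> y x"
  by (simp add: height_def max.commute)

context
  fixes t :: "'a::comm_ring_1" and T :: real and \<nu> :: "'a \<Rightarrow> real"
  assumes sn: "expanding_seminorm t T \<nu>" and T: "100 \<le> T"
begin

lemma sn_1: "\<nu> 1 = 1" and sn_nonneg: "0 \<le> \<nu> x" and sn_add: "\<nu> (x + y) \<le> \<nu> x + \<nu> y"
  and sn_minus: "\<nu> (- x) = \<nu> x" and sn_t: "\<nu> (t * x) = T * \<nu> x"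
  using sn by (auto simp: expanding_seminorm_def)

lemma sn_diff: "\<nu> (x - y) \<le> \<nu> x + \<nu> y"
  using sn_add[of x "- y"] by (simp add: sn_minus)

lemma sn_scale: "\<nu> (s * x) = T * \<nu> x" if "s = t \<or> s = - t"
  using that sn_minus[of "t * x"] by (auto simp: sn_t)

lemma sn_scale_unit: "\<nu> s = T" if "s = t \<or> s = - t"
  using sn_scale[OF that, of 1] by (simp add: sn_1)

text \<open>If the height does not rise, \<open>T\<close> times the size of the intermediate
  \<open>y + s * x\<close> is at most twice the height. So this value is small and the point lies
  near the line \<open>y = - s * x\<close>.\<close>

lemma linear_step_strip:
  assumes s: "s = t \<or> s = - t"
    and le: "height \<nu> (x + s * (y + s * x)) (y + s * x) \<le> height \<nu> x y"
  shows "T * \<nu> x \<le> \<nu> y + height \<nu> x y / 50" "\<nu> y \<le> T * \<nu> x + height \<nu> x y / 50"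
proof -
  let ?M = "height \<nu> x y" and ?z = "y + s * x"
  have "T * \<nu> ?z \<le> \<nu> (x + s * ?z) + \<nu> x"
    using sn_diff[of "x + s * ?z" x] sn_scale[OF s, of ?z] by simp
  also have "\<dots> \<le> 2 * ?M"
    using le height_ge(2)[of \<nu> "x + s * ?z" ?z] height_ge(2)[of \<nu> x y] by linarith
  finally have "T * \<nu> ?z \<le> 2 * ?M" .
  moreover have "100 * \<nu> ?z \<le> T * \<nu> ?z" using T sn_nonneg by (rule mult_right_mono)
  ultimately have z: "\<nu> ?z \<le> ?M / 50" by linarith
  show "T * \<nu> x \<le> \<nu> y + ?M / 50"
    using z sn_diff[of ?z y] sn_scale[OF s, of x] by simp
  show "\<nu> y \<le> T * \<nu> x + ?M / 50"
    using z sn_diff[of ?z "s * x"] sn_scale[OF s, of x] by simp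
qed

text \<open>The intermediate coordinate \<open>w\<close> is again small. Since
  \<open>w - x = s * (t * y + 1)\<close>, the size \<open>u\<close> of \<open>t * y + 1\<close> is
  small compared with the height, a strip around the line \<open>t * y = - 1\<close>.\<close>

lemma affine_step_strip:
  assumes s: "s = t \<or> s = - t"
    and w: "w = x + t * s * y + s"
    and le: "height \<nu> w (y + t * s * w + s) \<le> height \<nu> x y"
  obtains u where "0 \<le> u" "T * \<nu> y \<le> 1 + u" "1 \<le> T * \<nu> y + u" "100 * u \<le> \<nu> x + height \<nu> x y / 100"
proof -
  let ?M = "height \<nu> x y"
  have ts: "\<nu> (t * s * a) = T * (T * \<nu> a)" for a
    using sn_scale[OF s, of a] by (simp add: sn_t mult.assoc)
  have M: "2 \<le> ?M" by (simp add: height_def)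
  have "T * (T * \<nu> w) \<le> \<nu> (y + t * s * w + s) + (\<nu> y + \<nu> s)"
    using sn_diff[of "y + t * s * w + s" "y + s"] sn_add[of y s] ts[of w] by simp
  also have "\<dots> \<le> 2 * ?M + T" using le sn_scale_unit[OF s] height_ge(3)[of \<nu> "y + t * s * w + s" w] height_ge(3)[of \<nu> y x]
    by linarith
  \<comment> \<open>The lower bound 2 on the height leaves room to absorb the translation term
    \<open>T\<close>.\<close>
  also have "\<dots> \<le> T * ?M" 
  proof -
    have "0 \<le> (T - 100) * (?M - 2)" using T M by simp
    then show ?thesis using T M by (simp add: algebra_simps)
  qed
  finally have "T * \<nu> w \<le> ?M" using T by simp
  moreover have "100 * \<nu> w \<le> T * \<nu> w" using T sn_nonneg by (rule mult_right_mono)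
  ultimately have nw: "\<nu> w \<le> ?M / 100" by linarith
  let ?u = "t * y + 1"
  have "s * ?u = w - x" by (simp add: w algebra_simps)
  then have "T * \<nu> ?u \<le> \<nu> x + ?M / 100" using sn_scale[OF s, of ?u] sn_diff[of w x] nw by simp
  moreover have "100 * \<nu> ?u \<le> T * \<nu> ?u" using T sn_nonneg by (rule mult_right_mono)
  moreover have "T * \<nu> y \<le> 1 + \<nu> ?u" using sn_diff[of ?u 1] by (simp add: sn_t sn_1)
  moreover have "1 \<le> T * \<nu> y + \<nu> ?u" using sn_diff[of ?u "t * y"] by (simp add: sn_t sn_1)
  ultimately show ?thesis using that[of "\<nu> ?u"] sn_nonneg by linarith
qed

text \<open>The first two conditions describe strips around lines through the origin, the last two strips
  around lines missing it; the four lines are in general position.\<close>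

lemma strips_general_position:
  fixes x y :: 'a
  defines "M \<equiv> height \<nu> x y"
  defines "strip1 \<equiv> height \<nu> (x + t * (y + t * x)) (y + t * x) \<le> M"
    and "strip2 \<equiv> height \<nu> (x - t * y) (y - t * (x - t * y)) \<le> M"
    and "strip3 \<equiv> height \<nu> (x + t\<^sup>2 * y + t) (y + t\<^sup>2 * (x + t\<^sup>2 * y + t) + t) \<le> M"
    and "strip4 \<equiv> height \<nu> (x - t\<^sup>2 * (y - t\<^sup>2 * x - t) - t) (y - t\<^sup>2 * x - t) \<le> M"
  shows "strip1 \<and> strip2 \<or> strip1 \<and> strip3 \<or> strip1 \<and> strip4 \<or> strip2 \<and> strip3 \<or>
      strip2 \<and> strip4 \<or> strip3 \<and> strip4 \<Longrightarrow> M = 2"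
    and "\<not> (strip1 \<and> strip2 \<and> strip3)" "\<not> (strip1 \<and> strip2 \<and> strip4)"
      "\<not> (strip1 \<and> strip3 \<and> strip4)" "\<not> (strip2 \<and> strip3 \<and> strip4)"
proof -
  define p q where "p = \<nu> x" and "q = \<nu> y"
  \<comment> \<open>The sizes of \<open>t * x\<close> and \<open>t * y\<close>; the strips become
    linear inequalities between these numbers, \<open>M\<close> and the widths
    \<open>u\<close>.\<close>
  define P Q where "P = T * p" and "Q = T * q"
  have pq: "0 \<le> p" "0 \<le> q" "100 * p \<le> P" "100 * q \<le> Q"
    using T sn_nonneg by (auto simp: p_def q_def P_def Q_def intro: mult_right_mono)
  have M: "2 \<le> M" "p \<le> M" "q \<le> M" and M_cases: "M = 2 \<or> M = p \<or> M = q"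
    by (auto simp: M_def height_def p_def q_def)
  have s1: "P \<le> q + M / 50 \<and> q \<le> P + M / 50" if strip1
    unfolding P_def p_def q_def M_def
    using linear_step_strip[of t x y] that[unfolded strip1_def M_def] by blast
  \<comment> \<open>The inverse map is the original one with coordinates exchanged and
    \<open>t\<close> negated, so the same strip lemma applies; \<open>strip4\<close> arises likewise
    from the affine case.\<close>
  have "height \<nu> (y + - t * (x + - t * y)) (x + - t * y) \<le> height \<nu> y x" if strip2
    using that[unfolded strip2_def M_def]
    by (simp only: height_commute[of \<nu> y x] height_commute[of \<nu> "y + _"]) simp
  then have s2: "Q \<le> p + M / 50 \<and> p \<le> Q + M / 50" if strip2
    unfolding Q_def p_def q_def M_def
    using linear_step_strip[of "- t" y x] that height_commute[of \<nu> x y] by simp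
  have s3: "\<exists>u. 0 \<le> u \<and> Q \<le> 1 + u \<and> 1 \<le> Q + u \<and> 100 * u \<le> p + M / 100" if strip3
  proof -
    have "height \<nu> (x + t * t * y + t) (y + t * t * (x + t * t * y + t) + t) \<le> height \<nu> x y"
      using that by (simp add: strip3_def M_def power2_eq_square)
    from affine_step_strip[OF _ refl this] show ?thesis
      unfolding Q_def p_def q_def M_def by metis
  qed
  have s4: "\<exists>u. 0 \<le> u \<and> P \<le> 1 + u \<and> 1 \<le> P + u \<and> 100 * u \<le> q + M / 100" if strip4
  proof -
    have "height \<nu> (y + t * - t * x + - t) (x + t * - t * (y + t * - t * x + - t) + - t) \<le> height \<nu> y x"
      using that height_commute[of \<nu> y x] height_commute[of \<nu> "y - t\<^sup>2 * x - t"]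
      by (simp add: strip4_def M_def power2_eq_square)
    from affine_step_strip[OF _ refl this] show ?thesis
      unfolding P_def p_def q_def M_def height_commute[of \<nu> x y] by metis
  qed
  \<comment> \<open>If \<open>M\<close> is \<open>p\<close> or \<open>q\<close>, any two strip
    conditions bound it below 2.\<close>
  have pair: "M = 2" if "strip1 \<and> strip2 \<or> strip1 \<and> strip3 \<or> strip1 \<and> strip4 \<or> strip2 \<and> strip3 \<or>
      strip2 \<and> strip4 \<or> strip3 \<and> strip4"
    using that
  proof (elim disjE conjE)
    assume strip1 strip2
    from M_cases s1[OF \<open>strip1\<close>] s2[OF \<open>strip2\<close>] pq M show "M = 2" by (elim disjE) linarith+
  next
    assume strip1 strip3
    from s3[OF \<open>strip3\<close>] obtain u where "Q \<le> 1 + u" "100 * u \<le> p + M / 100" by blast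
    with M_cases s1[OF \<open>strip1\<close>] pq M show "M = 2" by (elim disjE) linarith+
  next
    assume strip1 strip4
    from s4[OF \<open>strip4\<close>] obtain u where "P \<le> 1 + u" "100 * u \<le> q + M / 100" by blast
    with M_cases s1[OF \<open>strip1\<close>] pq M show "M = 2" by (elim disjE) linarith+
  next
    assume strip2 strip3
    from s3[OF \<open>strip3\<close>] obtain u where "Q \<le> 1 + u" "100 * u \<le> p + M / 100" by blast
    with M_cases s2[OF \<open>strip2\<close>] pq M show "M = 2" by (elim disjE) linarith+
  next
    assume strip2 strip4
    from s4[OF \<open>strip4\<close>] obtain u where "P \<le> 1 + u" "100 * u \<le> q + M / 100" by blast
    with M_cases s2[OF \<open>strip2\<close>] pq M show "M = 2" by (elim disjE) linarith+
  next
    assume strip3 strip4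
    from s3[OF \<open>strip3\<close>] obtain u where "Q \<le> 1 + u" "100 * u \<le> p + M / 100" by blast
    moreover from s4[OF \<open>strip4\<close>] obtain u' where "P \<le> 1 + u'" "100 * u' \<le> q + M / 100" by blast
    ultimately show "M = 2" using M_cases pq M by (elim disjE) linarith+
  qed
  then show "strip1 \<and> strip2 \<or> strip1 \<and> strip3 \<or> strip1 \<and> strip4 \<or> strip2 \<and> strip3 \<or>
      strip2 \<and> strip4 \<or> strip3 \<and> strip4 \<Longrightarrow> M = 2" .
  \<comment> \<open>At \<open>M = 2\<close> the first two strips make \<open>P\<close> and
    \<open>Q\<close> nearly 0, whereas \<open>strip3\<close> makes \<open>Q\<close> and
    \<open>strip4\<close> makes \<open>P\<close> nearly 1.\<close>
  show "\<not> (strip1 \<and> strip2 \<and> strip3)"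
  proof (intro notI, elim conjE)
    assume strip1 strip2 strip3
    then have "M = 2" using pair by blast
    note s1[OF \<open>strip1\<close>]
    moreover
    note s2[OF \<open>strip2\<close>]
    moreover
    from s3[OF \<open>strip3\<close>] obtain u where "Q \<le> 1 + u" "1 \<le> Q + u" "100 * u \<le> p + M / 100" by blast
    ultimately show False using \<open>M = 2\<close> pq M by linarith
  qed
  show "\<not> (strip1 \<and> strip2 \<and> strip4)"
  proof (intro notI, elim conjE)
    assume strip1 strip2 strip4
    then have "M = 2" using pair by blast
    note s1[OF \<open>strip1\<close>]
    moreover
    note s2[OF \<open>strip2\<close>]
    moreover
    from s4[OF \<open>strip4\<close>] obtain u' where "P \<le> 1 + u'" "1 \<le> P + u'" "100 * u' \<le> q + M / 100" by blast
    ultimately show False using \<open>M = 2\<close> pq M by linarith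
  qed
  \<comment> \<open>Strips 3 and 4 make \<open>P\<close> and \<open>Q\<close> nearly 1, hence
    \<open>p\<close> and \<open>q\<close> tiny; then neither \<open>P \<le> q + M / 50\<close> nor
    \<open>Q \<le> p + M / 50\<close> can hold.\<close>
  show "\<not> (strip1 \<and> strip3 \<and> strip4)"
  proof (intro notI, elim conjE)
    assume strip1 strip3 strip4
    then have "M = 2" using pair by blast
    note s1[OF \<open>strip1\<close>]
    moreover
    from s3[OF \<open>strip3\<close>] obtain u where "Q \<le> 1 + u" "1 \<le> Q + u" "100 * u \<le> p + M / 100" by blast
    moreover
    from s4[OF \<open>strip4\<close>] obtain u' where "P \<le> 1 + u'" "1 \<le> P + u'" "100 * u' \<le> q + M / 100" by blast
    ultimately show False using \<open>M = 2\<close> pq M by linarith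
  qed
  show "\<not> (strip2 \<and> strip3 \<and> strip4)"
  proof (intro notI, elim conjE)
    assume strip2 strip3 strip4
    then have "M = 2" using pair by blast
    note s2[OF \<open>strip2\<close>]
    moreover
    from s3[OF \<open>strip3\<close>] obtain u where "Q \<le> 1 + u" "1 \<le> Q + u" "100 * u \<le> p + M / 100" by blast
    moreover
    from s4[OF \<open>strip4\<close>] obtain u' where "P \<le> 1 + u'" "1 \<le> P + u'" "100 * u' \<le> q + M / 100" by blast
    ultimately show False using \<open>M = 2\<close> pq M by linarith
  qed
qed

end

subsection \<open>Affine shears\<close>

context nonarch_valuation
begin

section \<open>Ultrametric estimates and composition in the affine group\<close>

lemma v_add_less: "v x < e \<Longrightarrow> v y < e \<Longrightarrow> v (x + y) < e"
  using v_add_le[of x y] by linarith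

lemma v_add_leI: "v x \<le> e \<Longrightarrow> v y \<le> e \<Longrightarrow> v (x + y) \<le> e"
  using v_add_le[of x y] by linarith

lemma v_mult_less:
  assumes "v x < e" "v y \<le> 1"
  shows "v (x * y) < e"
  using assms mult_left_le[of "v y" "v x"] v_nonneg[of x] by (simp add: v_mult)

lemma v_sum_less: "0 < e \<Longrightarrow> (\<And>k. k \<in> S \<Longrightarrow> v (f k) < e) \<Longrightarrow> v (sum f S) < e"
  by (induction S rule: infinite_finite_induct) (auto simp: v_0 intro: v_add_less)

lemma v_sum_le: "0 \<le> e \<Longrightarrow> (\<And>k. k \<in> S \<Longrightarrow> v (f k) \<le> e) \<Longrightarrow> v (sum f S) \<le> e"
  by (induction S rule: infinite_finite_induct) (auto simp: v_0 intro: v_add_leI)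

text \<open>Since \<open>\<epsilon> \<le> 1\<close>, closeness to the identity already makes the
  entries integral.\<close>

lemma SL_eps_iff:
  assumes "0 < \<epsilon>" "\<epsilon> \<le> 1"
  shows "L \<in> SL_eps v \<epsilon> \<longleftrightarrow> det L = 1 \<and> (\<forall>i j. v ((L - mat 1) $ i $ j) < \<epsilon>)"
proof -
  have "v (L $ i $ j) \<le> 1" if "v ((L - mat 1) $ i $ j) < \<epsilon>" for i j
    using that assms v_add_leI[of "(L - mat 1) $ i $ j" 1 "mat 1 $ i $ j"]
    by (auto simp: mat_def v_0 v_1 split: if_splits)
  then show ?thesis
    by (auto simp: SL_eps_def ring_of_integers_def mat_def split: if_splits)
qed

lemma SL_eps_mult:
  assumes \<epsilon>: "0 < \<epsilon>" "\<epsilon> \<le> 1" and L: "L \<in> SL_eps v \<epsilon>" and M: "M \<in> SL_eps v \<epsilon>"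
  shows "L ** M \<in> SL_eps v \<epsilon>"
proof -
  have "v ((L ** M - mat 1) $ i $ j) < \<epsilon>" for i j
  proof -
    \<comment> \<open>The splitting \<open>(L - mat 1) ** M + (M - mat 1)\<close> is small entrywise
      because \<open>M\<close> has integral entries.\<close>
    have "(L - mat 1) ** M = L ** M - mat 1 ** M"
      by (simp add: vec_eq_iff matrix_matrix_mult_def left_diff_distrib sum_subtractf)
    then have "L ** M - mat 1 = (L - mat 1) ** M + (M - mat 1)" by simp
    moreover have "v (((L - mat 1) ** M) $ i $ j) < \<epsilon>"
      unfolding matrix_matrix_mult_def vec_lambda_beta
    proof (rule v_sum_less[OF \<epsilon>(1)])
      fix k
      show "v ((L - mat 1) $ i $ k * M $ k $ j) < \<epsilon>"
        using L M SL_eps_iff[OF \<epsilon>] by (intro v_mult_less) (auto simp: SL_eps_def ring_of_integers_def)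
    qed
    moreover have "v ((M - mat 1) $ i $ j) < \<epsilon>" using M SL_eps_iff[OF \<epsilon>] by blast
    ultimately show ?thesis by (metis v_add_less vector_add_component)
  qed
  moreover have "det (L ** M) = 1" using L M by (simp add: det_mul SL_eps_def)
  ultimately show ?thesis using SL_eps_iff[OF \<epsilon>] by blast
qed

lemma SA_eps_comp:
  assumes \<epsilon>: "0 < \<epsilon>" "\<epsilon> \<le> 1" and f: "f \<in> SA_eps v \<epsilon>" and g: "g \<in> SA_eps v \<epsilon>"
  shows "f \<circ> g \<in> SA_eps v \<epsilon>"
proof -
  obtain L \<tau> where L: "L \<in> SL_eps v \<epsilon>" "\<And>i. v (\<tau> $ i) \<le> 1" "f = (\<lambda>x. L *v x + \<tau>)"
    using f by (auto simp: SA_eps_def ring_of_integers_def)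
  obtain M \<tau>' where M: "M \<in> SL_eps v \<epsilon>" "\<And>i. v (\<tau>' $ i) \<le> 1" "g = (\<lambda>x. M *v x + \<tau>')"
    using g by (auto simp: SA_eps_def ring_of_integers_def)
  have "f \<circ> g = (\<lambda>x. (L ** M) *v x + (L *v \<tau>' + \<tau>))"
    by (auto simp: L M matrix_vector_right_distrib matrix_vector_mul_assoc)
  moreover have "v ((L *v \<tau>') $ i) \<le> 1" for i
    unfolding matrix_vector_mult_def vec_lambda_beta
    by (rule v_sum_le)
      (use L M v_nonneg in \<open>auto simp: SL_eps_def ring_of_integers_def v_mult intro!: mult_le_one\<close>)
  then have "\<forall>i. (L *v \<tau>' + \<tau>) $ i \<in> ring_of_integers v"
    using L by (auto simp: ring_of_integers_def intro: v_add_leI)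
  ultimately show ?thesis unfolding SA_eps_def using SL_eps_mult[OF \<epsilon> L(1) M(1)] by blast
qed

lemma id_in_SA_eps:
  assumes "0 < \<epsilon>" "\<epsilon> \<le> 1"
  shows "id \<in> SA_eps v \<epsilon>"
proof -
  have "mat 1 \<in> SL_eps v \<epsilon>" using assms by (simp add: SL_eps_iff v_0 det_I)
  moreover have "id = (\<lambda>x::'a^'n. mat 1 *v x + 0)" by auto
  moreover have "\<forall>i. (0::'a^'n) $ i \<in> ring_of_integers v" by (simp add: ring_of_integers_def v_0)
  ultimately show ?thesis unfolding SA_eps_def by blast
qed

end

definition shear :: "'n \<Rightarrow> 'n \<Rightarrow> 'a \<Rightarrow> 'a \<Rightarrow> 'a::comm_ring_1 ^ 'n \<Rightarrow> 'a ^ 'n" where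
  "shear i j c d x = (\<chi> k. if k = i then x $ i + c * x $ j + d else x $ k)"

lemma shear_nth: "shear i j c d x $ k = (if k = i then x $ i + c * x $ j + d else x $ k)"
  by (simp add: shear_def)

lemma shear_shear_inverse:
  assumes "i \<noteq> j"
  shows "shear i j (- c) (- d) (shear i j c d x) = x" "shear i j c d (shear i j (- c) (- d) x) = x"
  using assms by (simp_all add: vec_eq_iff shear_nth)

context nonarch_valuation
begin

lemma shear_in_SA_eps:
  fixes i j :: "'n::finite"
  assumes \<epsilon>: "0 < \<epsilon>" "\<epsilon> \<le> 1" and "i \<noteq> j" "v c < \<epsilon>" "v d \<le> 1"
  shows "shear i j c d \<in> SA_eps v \<epsilon>"
proof -
  define L :: "'a^'n^'n" where "L = (\<chi> k. if k = i then row i (mat 1) + c *s row j (mat 1) else row k (mat 1))"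
  define \<tau> :: "'a^'n" where "\<tau> = (\<chi> k. if k = i then d else 0)"
  have "det L = 1" unfolding L_def using det_row_operation[OF \<open>i \<noteq> j\<close>, of "mat 1" c] by (simp add: det_I)
  moreover have "v ((L - mat 1) $ k $ l) < \<epsilon>" for k l
    using assms by (auto simp: L_def row_def mat_def v_0)
  ultimately have "L \<in> SL_eps v \<epsilon>" using SL_eps_iff[OF \<epsilon>] by blast
  moreover have "\<forall>k. \<tau> $ k \<in> ring_of_integers v" using assms by (simp add: \<tau>_def ring_of_integers_def v_0)
  moreover have "shear i j c d = (\<lambda>x. L *v x + \<tau>)"
  proof
    fix x :: "'a^'n"
    have sel: "(\<Sum>l\<in>UNIV. (if k = l then 1 else 0) * x $ l) = x $ k" for k :: 'n
      by (simp add: if_distrib[of "\<lambda>a. a * _"] cong: if_cong)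
    have "(L *v x) $ k = (if k = i then x $ i + c * x $ j else x $ k)" for k
    proof (cases "k = i")
      case True
      then have "(L *v x) $ k = (\<Sum>l\<in>UNIV. (if i = l then 1 else 0) * x $ l) +
          c * (\<Sum>l\<in>UNIV. (if j = l then 1 else 0) * x $ l)"
        by (simp add: matrix_vector_mult_def L_def row_def mat_def sum.distrib sum_distrib_left
            algebra_simps)
      then show ?thesis using True by (simp only: sel) simp
    next
      case False
      then show ?thesis using sel[of k] by (simp add: matrix_vector_mult_def L_def row_def mat_def)
    qed
    then show "shear i j c d x = L *v x + \<tau>" by (auto simp: vec_eq_iff shear_nth \<tau>_def)
  qed
  ultimately show ?thesis unfolding SA_eps_def by blast
qed

section \<open>Balls and spheres under displacements smaller than the radius\<close>

lemma max_norm_le_iff: "max_norm v x \<le> r \<longleftrightarrow> (\<forall>i. v (x $ i) \<le> r)"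
  by (simp add: max_norm_def)

lemma max_norm_less_iff: "max_norm v x < r \<longleftrightarrow> (\<forall>i. v (x $ i) < r)"
  by (simp add: max_norm_def)

lemma max_norm_add:
  fixes x y :: "'a ^ 'n"
  shows "max_norm v (x + y) \<le> max (max_norm v x) (max_norm v y)"
proof -
  have "v (x $ i) \<le> max_norm v x" for x :: "'a^'n" and i using max_norm_le_iff[of x] by blast
  then have "v ((x + y) $ i) \<le> max (max_norm v x) (max_norm v y)" for i
    using v_add_leI[of "x $ i" _ "y $ i"] by (simp add: max.coboundedI1 max.coboundedI2)
  then show ?thesis by (simp only: max_norm_le_iff) blast
qed

lemma max_norm_minus: "max_norm v (- x) = max_norm v x"
  by (simp add: max_norm_def v_minus)

text \<open>From \<open>0 \<in> E\<close> the centre has norm at most \<open>r\<close>, and the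
  ultrametric inequality carries the bound over from \<open>x - c\<close> to
  \<open>x\<close>.\<close>

lemma max_norm_ball_or_sphere:
  assumes "E = open_ball v c r \<or> E = closed_ball v c r \<or> E = val_sphere v c r" "0 \<in> E" "x \<in> E"
  shows "max_norm v x \<le> r"
  using assms max_norm_add[of "x - c" c] max_norm_minus[of c]
  by (auto simp: open_ball_def closed_ball_def val_sphere_def)

text \<open>By the ultrametric inequality a displacement below \<open>r\<close> respects both ball
  conditions; for a sphere it is applied both ways between \<open>x - c\<close> and
  \<open>y - c\<close>.\<close>

lemma ball_or_sphere_perturbation:
  assumes "E = open_ball v c r \<or> E = closed_ball v c r \<or> E = val_sphere v c r" "x \<in> E"
    and "max_norm v (y - x) < r"
  shows "y \<in> E"
  using assms max_norm_add[of "x - c" "y - x"] max_norm_add[of "y - c" "x - y"] max_norm_minus[of "y - x"]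
  by (auto simp: open_ball_def closed_ball_def val_sphere_def max_def split: if_splits)

lemma shear_ball_or_sphere:
  assumes E: "E = open_ball v c0 r \<or> E = closed_ball v c0 r \<or> E = val_sphere v c0 r" "0 \<in> E"
    and "0 < r" "v c < 1" "v d < r" "x \<in> E"
  shows "shear i j c d x \<in> E"
proof (rule ball_or_sphere_perturbation[OF E(1) \<open>x \<in> E\<close>])
  have "v (x $ j) \<le> r" using max_norm_ball_or_sphere[OF E \<open>x \<in> E\<close>] by (simp add: max_norm_le_iff)
  moreover have "v c * v (x $ j) \<le> v c * r"
    using calculation v_nonneg by (rule mult_left_mono)
  moreover have "v c * r < r" using assms by simp
  ultimately have "v c * v (x $ j) < r" by linarith
  then have "v (c * x $ j + d) < r" using assms by (intro v_add_less) (simp_all add: v_mult)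
  then show "max_norm v (shear i j c d x - x) < r"
    using assms by (simp add: max_norm_less_iff shear_nth v_0 add.assoc)
qed

end

theorem theorem5p4:
  fixes v :: "'a::field \<Rightarrow> real" and \<epsilon> r :: real and c :: "'a ^ 'n" and E :: "('a ^ 'n) set"
  assumes "nonarch_valuation v"
    and "nontrivial_valuation v"
    and "0 < \<epsilon>" and "\<epsilon> \<le> 1"
    and "2 \<le> CARD('n)"
    and "0 < r"
    and "E = open_ball v c r \<or> E = closed_ball v c r \<or> E = val_sphere v c r"
    and "0 \<in> E"
  shows "paradoxical (SA_eps v \<epsilon>) 4 E"
proof -
  interpret nonarch_valuation v by fact
  note \<epsilon> = assms(3,4)
  obtain i j :: 'n where ij: "i \<noteq> j"
    using assms(5) by (metis (full_types) card_2_iff' ex_card[of 2 "UNIV::'n set"])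
  \<comment> \<open>Values below \<open>\<epsilon>\<close> put the shears into the group, values
    below \<open>r\<close> let the translation by \<open>t\<close> preserve \<open>E\<close>; 100 is
    the expansion required by the strip estimates.\<close>
  have "0 < min \<epsilon> r" using assms(3,6) by simp
  then obtain t T \<nu> where t: "v t < min \<epsilon> r" and T: "100 \<le> T" and sn: "expanding_seminorm t T \<nu>"
    using expanding_seminorm_exists[OF assms(2), of "min \<epsilon> r" 100] by auto
  have vt: "v t < \<epsilon>" "v t < r" "v t < 1" "v t \<le> 1" using t \<epsilon> by auto
  have vt2: "v (t\<^sup>2) < \<epsilon>" "v (t\<^sup>2) < 1"
    using v_mult_less[OF vt(1,4)] v_mult_less[OF vt(3,4)] by (simp_all add: power2_eq_square)
  \<comment> \<open>\<open>True\<close> as first component labels the linear map,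
    \<open>False\<close> the affine one; the second component selects the map or its inverse. The
    four cases match the four strips.\<close>
  define step where "step = (\<lambda>(e, b).
    if e then if b then shear i j t 0 \<circ> shear j i t 0 else shear j i (- t) 0 \<circ> shear i j (- t) 0
    else if b then shear j i (t\<^sup>2) t \<circ> shear i j (t\<^sup>2) t
    else shear i j (- (t\<^sup>2)) (- t) \<circ> shear j i (- (t\<^sup>2)) (- t))"
  define h where "h = (\<lambda>x. height \<nu> (x $ i) (x $ j))"
  have h: "h x = height \<nu> (x $ i) (x $ j)" for x by (simp add: h_def)
  have steps: "h (step (True, True) x) = height \<nu> (x $ i + t * (x $ j + t * x $ i)) (x $ j + t * x $ i)"
    "h (step (True, False) x) = height \<nu> (x $ i - t * x $ j) (x $ j - t * (x $ i - t * x $ j))"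
    "h (step (False, True) x) = height \<nu> (x $ i + t\<^sup>2 * x $ j + t)
       (x $ j + t\<^sup>2 * (x $ i + t\<^sup>2 * x $ j + t) + t)"
    "h (step (False, False) x) = height \<nu> (x $ i - t\<^sup>2 * (x $ j - t\<^sup>2 * x $ i - t) - t)
       (x $ j - t\<^sup>2 * x $ i - t)" for x
    unfolding h step_def using ij by (simp_all add: shear_nth)
  define S where "S = (\<lambda>x s. h (step s x) \<le> h x)"
  note strips = strips_general_position[OF sn T, of "x $ i" "x $ j" for x]
  have S2: "S x (True, True) \<and> S x (True, False) \<or> S x (True, True) \<and> S x (False, True) \<or>
    S x (True, True) \<and> S x (False, False) \<or> S x (True, False) \<and> S x (False, True) \<or>
    S x (True, False) \<and> S x (False, False) \<or> S x (False, True) \<and> S x (False, False) \<Longrightarrow> h x = 2" for x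
    using strips(1) unfolding S_def steps unfolding h .
  have S3: "\<not> (S x (True, True) \<and> S x (True, False) \<and> S x (False, True))"
    "\<not> (S x (True, True) \<and> S x (True, False) \<and> S x (False, False))"
    "\<not> (S x (True, True) \<and> S x (False, True) \<and> S x (False, False))"
    "\<not> (S x (True, False) \<and> S x (False, True) \<and> S x (False, False))" for x
    using strips(2-)[of x] unfolding S_def steps unfolding h by blast+
  have pair: "h x = 2" if "S x (e, b)" "S x (e', b')" "(e, b) \<noteq> (e', b')" for x e b e' b'
    using that S2[of x] by (cases e; cases b; cases e'; cases b') simp_all
  have triple: "\<not> (S x (e1, b1) \<and> S x (e2, b2) \<and> S x (e3, b3))"
    if "distinct [(e1, b1), (e2, b2), (e3, b3)]" for x e1 b1 e2 b2 e3 b3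
    using that S3[of x] by (cases e1; cases b1; cases e2; cases b2; cases e3; cases b3) auto
  show ?thesis
  proof (rule paradoxical_of_height[where step = step and h = h])
    show "step (e, \<not> b) (step (e, b) x) = x" for e b x
      using shear_shear_inverse[OF ij, of t 0] shear_shear_inverse[OF ij[symmetric], of t 0]
        shear_shear_inverse[OF ij, of "t\<^sup>2" t] shear_shear_inverse[OF ij[symmetric], of "t\<^sup>2" t]
      by (cases e; cases b) (simp_all add: step_def)
    show "h x < h (step s' x)" if "s \<noteq> s'" "h (step s x) < h x" for x s s'
    proof -
      \<comment> \<open>A fall ends at height at least 2, so \<open>h x > 2\<close>, and
        \<open>pair\<close> excludes a second non-rising direction.\<close>
      have "2 \<le> h (step s x)" by (simp add: h_def height_ge)
      then show ?thesis using pair[of x "fst s" "snd s" "fst s'" "snd s'"] that by (force simp: S_def)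
    qed
    show "h x < h (step s1 x) \<or> h x < h (step s2 x) \<or> h x < h (step s3 x)"
      if "distinct [s1, s2, s3]" for x s1 s2 s3
      using triple[of "fst s1" "snd s1" "fst s2" "snd s2" "fst s3" "snd s3" x] that
      by (simp add: S_def not_le)
    show "E \<noteq> {}" using assms(8) by blast
    show "step s x \<in> E" if "x \<in> E" for s x
      using that vt vt2 assms(6)
      by (cases s) (auto simp: step_def v_minus v_0 intro!: shear_ball_or_sphere[OF assms(7,8)])
    show "id \<in> SA_eps v \<epsilon>" by (rule id_in_SA_eps[OF \<epsilon>])
    show "step (e, True) \<in> SA_eps v \<epsilon>" for e
      using ij vt vt2 by (auto simp: step_def v_0 intro!: SA_eps_comp[OF \<epsilon>] shear_in_SA_eps[OF \<epsilon>])
  qed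
qed

end
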